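(* Let $(q_k)_{k\ge 1}$ be a sequence of positive integers with $q_{k+1}\ge q_k(q_k+1)$ for all $k\ge 1$, let $(\xi_k)_{k\ge1}$ be independent random variables with $\mathsf{P}\{\xi_k=0\}=p_{0k}$, $\mathsf{P}\{\xi_k=1\}=p_{1k}$, $p_{0k},p_{1k}\ge 0$, $p_{0k}+p_{1k}=1$, and let $$\xi=\sum_{k=1}^\infty \frac{(-1)^{k+1}\xi_k}{q_k}.$$ Then the spectrum $S_\xi$ of the distribution of $\xi$ is a nowhere dense subset of $\mathbb{R}$ of zero Hausdorff dimension.
   Context: The spectrum (topological support) $S_\xi$ of the distribution of a real random variable $\xi$ is its minimal closed support, i.e. $S_\xi=\{x\in\mathbb{R}:\ \mathsf{P}\{\xi\in(x-\varepsilon,x+\varepsilon)\}>0\ \ \forall\varepsilon>0\}$. *)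

theory Defs
  imports "HOL-Probability.Probability"
begin

definition nowhere_dense :: "'a::topological_space set \<Rightarrow> bool" where
  "nowhere_dense S \<longleftrightarrow> interior (closure S) = {}"

definition spectrum :: "'a measure \<Rightarrow> ('a \<Rightarrow> real) \<Rightarrow> real set" where
  "spectrum M X = {x. \<forall>\<epsilon>>0. \<P>(\<omega> in M. X \<omega> \<in> {x - \<epsilon><..<x + \<epsilon>}) > 0}"

(* The case s = 0 is separate because 0 powr 0 = 0 in HOL, whereas the
   convention here is diam(U)^0 = 1 for nonempty U (and 0 for U = {}),
   so that the measure of dimension 0 is the counting measure. *)
definition hausdorff_gauge :: "real \<Rightarrow> 'a::metric_space set \<Rightarrow> ennreal" where
  "hausdorff_gauge s U =
     (if U = {} then 0 else if s = 0 then 1 else ennreal (diameter U powr s))"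

(* Countable covers are sequences of sets; finite covers are included because
   the empty set is allowed. Boundedness is required since diameter is a
   real-valued supremum, with no meaningful value on unbounded sets. *)
definition delta_covers :: "real \<Rightarrow> 'a::metric_space set \<Rightarrow> (nat \<Rightarrow> 'a set) set" where
  "delta_covers \<delta> A =
     {U. A \<subseteq> (\<Union>i. U i) \<and> (\<forall>i. bounded (U i) \<and> diameter (U i) \<le> \<delta>)}"

definition hausdorff_premeasure :: "real \<Rightarrow> real \<Rightarrow> 'a::metric_space set \<Rightarrow> ennreal" where
  "hausdorff_premeasure s \<delta> A = (INF U\<in>delta_covers \<delta> A. \<Sum>i. hausdorff_gauge s (U i))"

definition hausdorff_measure :: "real \<Rightarrow> 'a::metric_space set \<Rightarrow> ennreal" where
  "hausdorff_measure s A = (SUP \<delta>\<in>{0<..}. hausdorff_premeasure s \<delta> A)"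

definition hausdorff_dim :: "'a::metric_space set \<Rightarrow> ennreal" where
  "hausdorff_dim A = Inf (ennreal ` {s. s \<ge> 0 \<and> hausdorff_measure s A = 0})"

end

theory Submission
  imports Defs "HOL-Real_Asymp.Real_Asymp"
begin

text \<open>
  Write \<open>a j = q (j + 1)\<close>. Almost surely every \<open>\<xi> k\<close> is 0 or 1, and then fixing the first \<open>n\<close> digits
  determines \<open>X\<close> up to the tail of the series. The growth condition at least doubles the
  denominators at each step, so the tail is at most \<open>2 / a n\<close>: the variable \<open>X\<close> almost surely
  lies in a union of at most \<open>2 ^ n\<close> closed balls of radius \<open>2 / a n\<close>
  (\<open>signed_sum_near_partial_sums\<close>). This union is closed and carries all the mass, so it contains
  the spectrum (\<open>spectrum_subset_closed\<close>).

  The growth condition also gives \<open>a (n + 1) \<ge> (a n)\<^sup>2\<close>, so \<open>a n\<close> grows doubly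
  exponentially and beats the number \<open>2 ^ n\<close> of balls to every positive power: for every \<open>s > 0\<close> the
  number of balls times the \<open>s\<close>-th power of their common diameter tends to 0
  (\<open>finite_ball_covers_if_near_partial_sums\<close>). Both conclusions follow from this one fact. All
  \<open>s > 0\<close> together make every Hausdorff measure of positive dimension vanish. The single exponent
  \<open>s = 1\<close> gives nowhere density: a finite union of closed balls also covers the closure of the
  spectrum, and its length is too small to contain an interval.
\<close>

section \<open>Finite covers by small balls of equal radius\<close>

text \<open>
  This says that the \<open>s\<close>-dimensional lower Minkowski content of \<open>A\<close> vanishes. Finiteness of the
  cover makes the property pass from \<open>A\<close> to its closure, which countable covers do not allow: the
  rationals have Hausdorff dimension 0 but are dense. For \<open>s > 0\<close> and a
  nonempty \<open>C\<close>, a small total \<open>card C * (2 * r) powr s\<close> forces the radius to be small as well.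
\<close>

definition finite_ball_covers :: "real \<Rightarrow> real set \<Rightarrow> bool" where
  "finite_ball_covers s A \<longleftrightarrow>
     (\<forall>e>0. \<exists>C r. finite C \<and> 0 \<le> r \<and> A \<subseteq> (\<Union>c\<in>C. cball c r) \<and>
        real (card C) * (2 * r) powr s < e)"

lemma hausdorff_measure_0I:
  assumes "\<And>\<delta> e. \<delta> > 0 \<Longrightarrow> e > 0 \<Longrightarrow>
    \<exists>U\<in>delta_covers \<delta> A. (\<Sum>i. hausdorff_gauge s (U i)) \<le> ennreal e"
  shows "hausdorff_measure s A = 0"
proof -
  have "hausdorff_premeasure s \<delta> A = 0" if "\<delta> > 0" for \<delta>
  proof -
    have "hausdorff_premeasure s \<delta> A \<le> 0 + ennreal e" if e: "e > 0" for e
      unfolding hausdorff_premeasure_def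
      using assms[OF \<open>\<delta> > 0\<close> e] by (auto intro: INF_lower2)
    then show ?thesis
      using ennreal_le_epsilon[of 0 "hausdorff_premeasure s \<delta> A"] by auto
  qed
  then show ?thesis
    by (auto simp: hausdorff_measure_def)
qed

text \<open>
  A finite ball cover is turned into a sequence of sets by padding with the empty set, whose gauge
  is 0.
\<close>

lemma hausdorff_measure_0_if_finite_ball_covers:
  assumes cov: "finite_ball_covers s A" and s: "s > 0"
  shows "hausdorff_measure s A = 0"
proof (rule hausdorff_measure_0I)
  fix \<delta> e :: real
  assume pos: "\<delta> > 0" "e > 0"
  \<comment> \<open>The bound \<open>\<delta> powr s\<close> is what makes the diameters of the balls at most \<open>\<delta>\<close>.\<close>
  then have "min e (\<delta> powr s) > 0"
    by simp
  with cov obtain C r where C: "finite C" "0 \<le> r" "A \<subseteq> (\<Union>c\<in>C. cball c r)"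
    and small: "real (card C) * (2 * r) powr s < min e (\<delta> powr s)"
    unfolding finite_ball_covers_def by meson
  obtain xs where xs: "set xs = C" "distinct xs"
    using finite_distinct_list[OF C(1)] by blast
  define U where "U i = (if i < length xs then cball (xs ! i) r else {})" for i
  have "(\<Sum>i. hausdorff_gauge s (U i)) = (\<Sum>i<length xs. hausdorff_gauge s (U i))"
    by (rule suminf_finite) (auto simp: U_def hausdorff_gauge_def)
  also have "\<dots> = (\<Sum>i<length xs. ennreal ((2 * r) powr s))"
    using C(2) s by (intro sum.cong) (auto simp: U_def hausdorff_gauge_def)
  also have "\<dots> = ennreal (real (card C) * (2 * r) powr s)"
    using distinct_card[OF xs(2)] xs(1) by (simp add: ennreal_mult ennreal_of_nat_eq_real_of_nat)
  also have "\<dots> \<le> ennreal e"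
    using small by (intro ennreal_leI) auto
  finally have sum: "(\<Sum>i. hausdorff_gauge s (U i)) \<le> ennreal e" .
  have "A \<subseteq> (\<Union>i. U i)"
  proof
    fix x assume "x \<in> A"
    then obtain c where c: "c \<in> set xs" "x \<in> cball c r"
      using C(3) xs(1) by blast
    then obtain i where "i < length xs" "xs ! i = c"
      by (auto simp: in_set_conv_nth)
    with c(2) show "x \<in> (\<Union>i. U i)"
      by (auto simp: U_def intro!: exI[of _ i])
  qed
  moreover have "bounded (U i) \<and> diameter (U i) \<le> \<delta>" for i
  proof (cases "i < length xs")
    case True
    then have "card C \<noteq> 0"
      using xs by (auto simp: distinct_card)
    then have "1 * (2 * r) powr s \<le> real (card C) * (2 * r) powr s"
      by (intro mult_right_mono) auto
    with small have "(2 * r) powr s < \<delta> powr s"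
      by linarith
    then have "2 * r < \<delta>"
      using s pos powr_mono2[of s \<delta> "2 * r"] by linarith
    then show ?thesis
      using True C(2) by (simp add: U_def)
  next
    case False
    then show ?thesis
      using pos by (simp add: U_def)
  qed
  ultimately have "U \<in> delta_covers \<delta> A"
    by (simp add: delta_covers_def)
  with sum show "\<exists>U\<in>delta_covers \<delta> A. (\<Sum>i. hausdorff_gauge s (U i)) \<le> ennreal e"
    by blast
qed

lemma hausdorff_dim_0_if_finite_ball_covers:
  assumes "\<And>s. s > 0 \<Longrightarrow> finite_ball_covers s A"
  shows "hausdorff_dim A = 0"
proof -
  have "hausdorff_dim A \<le> 0 + ennreal s" if "s > 0" for s
    unfolding hausdorff_dim_def
    using that hausdorff_measure_0_if_finite_ball_covers[OF assms[OF that] that]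
    by (auto intro!: Inf_lower)
  then show ?thesis
    using ennreal_le_epsilon[of 0 "hausdorff_dim A"] by auto
qed

text \<open>
  If the closure contained an interval, finitely many closed balls of smaller total length would
  cover that interval.
\<close>

lemma nowhere_dense_if_finite_ball_covers:
  assumes "finite_ball_covers 1 A"
  shows "nowhere_dense A"
  unfolding nowhere_dense_def
proof (rule ccontr)
  assume "interior (closure A) \<noteq> {}"
  then obtain x d where d: "d > 0" "cball x d \<subseteq> closure A"
    by (metis all_not_in_conv mem_interior_cball)
  from d(1) have "2 * d > 0"
    by simp
  with assms obtain C r where C: "finite C" "0 \<le> r" "A \<subseteq> (\<Union>c\<in>C. cball c r)"
    and small: "real (card C) * (2 * r) powr 1 < 2 * d"
    unfolding finite_ball_covers_def by meson
  have "closure A \<subseteq> (\<Union>c\<in>C. cball c r)"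
    using C by (intro closure_minimal closed_UN) auto
  with d(2) have sub: "{x - d..x + d} \<subseteq> (\<Union>c\<in>C. {c - r..c + r})"
    by (auto simp: cball_eq_atLeastAtMost)
  have "ennreal (2 * d) = emeasure lborel {x - d..x + d}"
    using d(1) by simp
  also have "\<dots> \<le> emeasure lborel (\<Union>c\<in>C. {c - r..c + r})"
    using sub C(1) by (intro emeasure_mono) auto
  also have "\<dots> \<le> (\<Sum>c\<in>C. emeasure lborel {c - r..c + r})"
    using C(1) by (intro emeasure_subadditive_finite) auto
  also have "\<dots> = ennreal (real (card C) * (2 * r))"
    using C(2) by (simp add: ennreal_mult ennreal_of_nat_eq_real_of_nat)
  finally show False
    using small C(2) d(1) by (simp add: ennreal_le_iff)
qed

section \<open>The spectrum lies in every closed set of full probability\<close>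

text \<open>
  A point outside \<open>F\<close> has a neighbourhood disjoint from \<open>F\<close>, and this neighbourhood has mass 0.
\<close>

lemma spectrum_subset_closed:
  assumes "closed F" and "AE \<omega> in M. X \<omega> \<in> F"
  shows "spectrum M X \<subseteq> F"
proof
  fix x assume x: "x \<in> spectrum M X"
  show "x \<in> F"
  proof (rule ccontr)
    assume "x \<notin> F"
    then obtain e where e: "e > 0" "ball x e \<subseteq> - F"
      using assms(1) openE[of "- F" x] by (auto simp: open_Compl)
    have "AE \<omega> in M. X \<omega> \<notin> {x - e<..<x + e}"
      using assms(2) by eventually_elim (use e(2) in \<open>auto simp: ball_eq_greaterThanLessThan\<close>)
    then have "\<P>(\<omega> in M. X \<omega> \<in> {x - e<..<x + e}) = 0"
      \<comment> \<open>The event may fail to be measurable; its measure is then 0 by convention.\<close>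
      by (cases "{\<omega> \<in> space M. X \<omega> \<in> {x - e<..<x + e}} \<in> sets M")
        (auto simp: AE_iff_measurable[OF _ refl] measure_def emeasure_notin_sets)
    with x e(1) show False
      unfolding spectrum_def by fastforce
  qed
qed

section \<open>Signed subsums of rapidly decreasing unit fractions\<close>

definition partial_sums :: "(nat \<Rightarrow> nat) \<Rightarrow> nat \<Rightarrow> real set" where
  "partial_sums a n = (\<lambda>B. \<Sum>j\<in>B. (-1) ^ j / real (a j)) ` Pow {..<n}"

lemma finite_partial_sums: "finite (partial_sums a n)"
  by (simp add: partial_sums_def)

lemma card_partial_sums_le: "card (partial_sums a n) \<le> 2 ^ n"
proof -
  have "card (partial_sums a n) \<le> card (Pow {..<n})"
    unfolding partial_sums_def by (rule card_image_le) simp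
  then show ?thesis
    by (simp add: card_Pow)
qed

context
  fixes a :: "nat \<Rightarrow> nat"
  assumes pos: "\<And>j. a j > 0"
    and step: "\<And>j. a (Suc j) \<ge> a j * (a j + 1)"
begin

lemma denominator_geometric_growth: "a n * 2 ^ i \<le> a (i + n)"
proof (induction i)
  case (Suc i)
  have "a n * 2 ^ Suc i \<le> a (i + n) * 2"
    using Suc by simp
  also have "\<dots> \<le> a (i + n) * (a (i + n) + 1)"
    using pos[of "i + n"] by (intro mult_left_mono) auto
  also have "\<dots> \<le> a (Suc i + n)"
    using step[of "i + n"] by simp
  finally show ?case .
qed simp

text \<open>
  Each step at least squares the denominator. Squaring makes no progress from the value 1, which
  \<open>a 0\<close> may take, so the induction starts at \<open>a 1 \<ge> 2\<close>; hence the shift of the index.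
\<close>

lemma denominator_double_exponential_growth: "2 ^ (2 ^ n) \<le> a (Suc n)"
proof (induction n)
  case 0
  show ?case
    using denominator_geometric_growth[of 0 1] pos[of 0] by simp
next
  case (Suc n)
  have "(2::nat) ^ (2 ^ Suc n) = 2 ^ (2 ^ n) * 2 ^ (2 ^ n)"
    by (simp add: mult_2 power_add)
  also have "\<dots> \<le> a (Suc n) * (a (Suc n) + 1)"
    using Suc by (intro mult_mono) auto
  also have "\<dots> \<le> a (Suc (Suc n))"
    by (rule step)
  finally show ?case .
qed

text \<open>
  The centre is the partial sum of the first \<open>n\<close> terms, and the remaining terms are dominated by
  the geometric series \<open>1 / a n * (1 + 1 / 2 + 1 / 4 + ...) = 2 / a n\<close>.
\<close>

lemma signed_sum_near_partial_sums:
  assumes x: "\<And>j. x j = 0 \<or> x j = (1::real)"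
  shows "(\<Sum>j. (-1) ^ j * x j / real (a j)) \<in> (\<Union>c\<in>partial_sums a n. cball c (2 / real (a n)))"
proof -
  define t where "t j = (-1) ^ j * x j / real (a j)" for j
  have t_le: "norm (t (i + n)) \<le> 1 / real (a n) * (1 / 2) ^ i" for i
  proof -
    have "norm (t (i + n)) \<le> 1 / real (a (i + n))"
      using x[of "i + n"] by (auto simp: t_def abs_mult power_abs)
    also have "\<dots> \<le> 1 / real (a n * 2 ^ i)"
      using denominator_geometric_growth[of n i] pos[of n]
      by (intro divide_left_mono) (auto simp del: of_nat_mult of_nat_power simp: pos)
    finally show ?thesis
      by (simp add: power_divide)
  qed
  have geo: "(\<lambda>i. 1 / real (a n) * (1 / 2) ^ i) sums (1 / real (a n) * (1 / (1 - 1 / 2)))"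
    by (intro sums_mult geometric_sums) simp
  have summable_norm_tail: "summable (\<lambda>i. norm (t (i + n)))"
    using t_le by (intro summable_comparison_test'[OF sums_summable[OF geo]]) auto
  have summable_tail: "summable (\<lambda>i. t (i + n))"
    using summable_norm_tail by (rule summable_norm_cancel)
  have "norm (\<Sum>i. t (i + n)) \<le> (\<Sum>i. norm (t (i + n)))"
    using summable_norm_tail by (rule summable_norm)
  also have "\<dots> \<le> 2 / real (a n)"
    using suminf_le[OF t_le summable_norm_tail sums_summable[OF geo]] sums_unique[OF geo] by simp
  finally have tail: "norm (\<Sum>i. t (i + n)) \<le> 2 / real (a n)" .
  have split: "(\<Sum>j. t j) = (\<Sum>i. t (i + n)) + (\<Sum>j<n. t j)"
    using summable_tail by (intro suminf_split_initial_segment) simp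
  have "(\<Sum>j<n. t j) = (\<Sum>j\<in>{j\<in>{..<n}. x j = 1}. (-1) ^ j / real (a j))"
    by (subst sum.inter_filter) (use x in \<open>fastforce simp: t_def intro!: sum.cong\<close>)+
  then have "(\<Sum>j<n. t j) \<in> partial_sums a n"
    unfolding partial_sums_def by (auto intro!: image_eqI)
  moreover have "(\<Sum>j. t j) \<in> cball (\<Sum>j<n. t j) (2 / real (a n))"
    using tail by (simp add: split dist_real_def)
  ultimately show ?thesis
    unfolding t_def by blast
qed

text \<open>
  The number of balls is at most exponential in \<open>n\<close>, their radius doubly exponentially small.
\<close>

lemma finite_ball_covers_if_near_partial_sums:
  assumes A: "\<And>n. A \<subseteq> (\<Union>c\<in>partial_sums a n. cball c (2 / real (a n)))" and s: "s > 0"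
  shows "finite_ball_covers s A"
  unfolding finite_ball_covers_def
proof (intro allI impI)
  fix e :: real assume "e > 0"
  have "(\<lambda>n. 2 ^ Suc n * (4 / 2 ^ (2 ^ n)) powr s) \<longlonglongrightarrow> 0"
    using s by real_asymp
  with \<open>e > 0\<close> have "\<forall>\<^sub>F n in sequentially. 2 ^ Suc n * (4 / 2 ^ (2 ^ n)) powr s < e"
    by (auto dest: order_tendstoD)
  then obtain n where n: "2 ^ Suc n * (4 / 2 ^ (2 ^ n)) powr s < e"
    by (meson eventually_sequentially order_refl)
  have "real (2 ^ (2 ^ n)) \<le> real (a (Suc n))"
    using denominator_double_exponential_growth by (rule of_nat_mono)
  then have "2 * (2 / real (a (Suc n))) \<le> 4 / 2 ^ (2 ^ n)"
    using pos[of "Suc n"] by (simp add: frac_le)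
  moreover have "real (card (partial_sums a (Suc n))) \<le> 2 ^ Suc n"
    using of_nat_mono[OF card_partial_sums_le[of a "Suc n"]] by simp
  ultimately have "real (card (partial_sums a (Suc n))) * (2 * (2 / real (a (Suc n)))) powr s
      \<le> 2 ^ Suc n * (4 / 2 ^ (2 ^ n)) powr s"
    using s by (intro mult_mono powr_mono2) auto
  with n have "real (card (partial_sums a (Suc n))) * (2 * (2 / real (a (Suc n)))) powr s < e"
    by linarith
  then show "\<exists>C r. finite C \<and> 0 \<le> r \<and> A \<subseteq> (\<Union>c\<in>C. cball c r) \<and> real (card C) * (2 * r) powr s < e"
    using A[of "Suc n"] finite_partial_sums[of a "Suc n"]
    by (intro exI[of _ "partial_sums a (Suc n)"] exI[of _ "2 / real (a (Suc n))"]) simp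
qed

end

section \<open>The spectrum of a random signed series of unit fractions\<close>

theorem theorem1:
  fixes M :: "'a measure"
    and q :: "nat \<Rightarrow> nat"
    and p0 p1 :: "nat \<Rightarrow> real"
    and \<xi> :: "nat \<Rightarrow> 'a \<Rightarrow> real"
    and X :: "'a \<Rightarrow> real"
  assumes "prob_space M"
    and "\<And>k. k \<ge> 1 \<Longrightarrow> q k > 0"
    and "\<And>k. k \<ge> 1 \<Longrightarrow> q (k + 1) \<ge> q k * (q k + 1)"
    and "prob_space.indep_vars M (\<lambda>_. borel) \<xi> {1..}"
    and "\<And>k. k \<ge> 1 \<Longrightarrow> \<P>(\<omega> in M. \<xi> k \<omega> = 0) = p0 k"
    and "\<And>k. k \<ge> 1 \<Longrightarrow> \<P>(\<omega> in M. \<xi> k \<omega> = 1) = p1 k"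
    and "\<And>k. k \<ge> 1 \<Longrightarrow> p0 k \<ge> 0 \<and> p1 k \<ge> 0 \<and> p0 k + p1 k = 1"
    and "\<And>\<omega>. X \<omega> = (\<Sum>j. let k = j + 1 in (-1) ^ (k + 1) * \<xi> k \<omega> / real (q k))"
  shows "nowhere_dense (spectrum M X) \<and> hausdorff_dim (spectrum M X) = 0"
proof -
  interpret prob_space M by fact
  define a where "a j = q (Suc j)" for j
  have a_pos: "a j > 0" for j
    using assms(2) by (simp add: a_def)
  have a_step: "a (Suc j) \<ge> a j * (a j + 1)" for j
    using assms(3)[of "Suc j"] by (simp add: a_def)
  have bit: "AE \<omega> in M. \<xi> (Suc j) \<omega> = 0 \<or> \<xi> (Suc j) \<omega> = 1" for j
  proof -
    have [measurable]: "random_variable borel (\<xi> (Suc j))"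
      using assms(4) by (auto simp: indep_vars_def)
    have "\<P>(\<omega> in M. \<xi> (Suc j) \<omega> = 0 \<or> \<xi> (Suc j) \<omega> = 1)
        = \<P>(\<omega> in M. \<xi> (Suc j) \<omega> = 0) + \<P>(\<omega> in M. \<xi> (Suc j) \<omega> = 1)"
      by (subst finite_measure_Union[symmetric]) (auto intro!: arg_cong[where f = prob])
    also have "\<dots> = 1"
      using assms(5,6,7)[of "Suc j"] by simp
    finally show ?thesis
      by (subst prob_Collect_eq_1[symmetric]) auto
  qed
  have X_eq: "X \<omega> = (\<Sum>j. (-1) ^ j * \<xi> (Suc j) \<omega> / real (a j))" for \<omega>
    by (simp add: assms(8) a_def)
  have near: "spectrum M X \<subseteq> (\<Union>c\<in>partial_sums a n. cball c (2 / real (a n)))" for n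
  proof (rule spectrum_subset_closed)
    show "closed (\<Union>c\<in>partial_sums a n. cball c (2 / real (a n)))"
      by (intro closed_UN finite_partial_sums) auto
    have "AE \<omega> in M. \<forall>j. \<xi> (Suc j) \<omega> = 0 \<or> \<xi> (Suc j) \<omega> = 1"
      using bit by (simp add: AE_all_countable)
    then show "AE \<omega> in M. X \<omega> \<in> (\<Union>c\<in>partial_sums a n. cball c (2 / real (a n)))"
      by eventually_elim
        (unfold X_eq, rule signed_sum_near_partial_sums[where a = a, OF a_pos a_step], blast)
  qed
  have "finite_ball_covers s (spectrum M X)" if "s > 0" for s
    using finite_ball_covers_if_near_partial_sums[where a = a, OF a_pos a_step near that] .
  then show ?thesis
    using nowhere_dense_if_finite_ball_covers hausdorff_dim_0_if_finite_ball_covers by simp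
qed

end
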